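(* Let $\alpha^\pm\ge 0$ with $\alpha^++\alpha^-=1$, let $\rho^\pm>0$, $c^\pm>0$, $\kappa\ge0$, and set $\rho=\alpha^+\rho^++\alpha^-\rho^-$. Define $c_\kappa,c_w>0$ by $$c_\kappa^2=\left(\alpha^+\frac{\rho+\kappa\rho^+}{\rho(1+\kappa)\rho^+}+\alpha^-\frac{\rho+\kappa\rho^-}{\rho(1+\kappa)\rho^-}\right)\frac{\rho^+\rho^-(c^+)^2(c^-)^2}{\alpha^+\rho^-(c^-)^2+\alpha^-\rho^+(c^+)^2},$$ $$c_w^2=\frac{\rho^+\rho^-(c^+)^2(c^-)^2}{\rho\left(\alpha^+\rho^-(c^-)^2+\alpha^-\rho^+(c^+)^2\right)}.$$ Let $c_0$ denote the value of $c_\kappa$ at $\kappa=0$. Then: (i) $\displaystyle c_0^2=\frac{(\alpha^-\rho^++\alpha^+\rho^-)(c^+)^2(c^-)^2}{\alpha^+\rho^-(c^-)^2+\alpha^-\rho^+(c^+)^2}$ and $\lim_{\kappa\to+\infty}c_\kappa=c_w$; (ii) $c_0\ge c_w$, and $c_0=c_w$ if and only if $\alpha^+\alpha^-(\rho^+-\rho^-)^2=0$; (iii) for every $\kappa\ge0$, $\displaystyle c_\kappa^2=\frac{\kappa\,c_w^2+c_0^2}{\kappa+1}$.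
   Context: The quantities $\alpha^\pm$, $\rho^\pm$, $c^\pm$ are the volume fractions, densities and sound speeds of two fluids labelled $+$ and $-$; $\kappa$ is a dimensionless added-mass coefficient. $c_w$ is Wood's speed of sound (one-velocity model), $c_0$ is the speed of sound of the two-velocity model without added mass, and $c_\kappa$ that of the two-velocity model with added mass. Only the displayed formulas are needed. *)

theory Defs
  imports Complex_Main
begin

text \<open>
  Arguments in order: volume fractions \<open>ap, am\<close> (\<open>\<alpha>\<^sup>+, \<alpha>\<^sup>-\<close>), densities \<open>rp, rm\<close> (\<open>\<rho>\<^sup>+, \<rho>\<^sup>-\<close>),
  sound speeds \<open>cp, cm\<close> (\<open>c\<^sup>+, c\<^sup>-\<close>) and the added-mass coefficient \<open>\<kappa>\<close>.
\<close>

definition mixture_density :: "real \<Rightarrow> real \<Rightarrow> real \<Rightarrow> real \<Rightarrow> real" where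
  "mixture_density ap am rp rm = ap * rp + am * rm"

definition added_mass_speed_sq ::
    "real \<Rightarrow> real \<Rightarrow> real \<Rightarrow> real \<Rightarrow> real \<Rightarrow> real \<Rightarrow> real \<Rightarrow> real" where
  "added_mass_speed_sq ap am rp rm cp cm \<kappa> =
     (let \<rho> = mixture_density ap am rp rm in
        (ap * ((\<rho> + \<kappa> * rp) / (\<rho> * (1 + \<kappa>) * rp)) +
         am * ((\<rho> + \<kappa> * rm) / (\<rho> * (1 + \<kappa>) * rm))) *
        ((rp * rm * cp\<^sup>2 * cm\<^sup>2) / (ap * rm * cm\<^sup>2 + am * rp * cp\<^sup>2)))"

definition wood_speed_sq ::
    "real \<Rightarrow> real \<Rightarrow> real \<Rightarrow> real \<Rightarrow> real \<Rightarrow> real \<Rightarrow> real" where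
  "wood_speed_sq ap am rp rm cp cm =
     (let \<rho> = mixture_density ap am rp rm in
        (rp * rm * cp\<^sup>2 * cm\<^sup>2) / (\<rho> * (ap * rm * cm\<^sup>2 + am * rp * cp\<^sup>2)))"

definition added_mass_speed ::
    "real \<Rightarrow> real \<Rightarrow> real \<Rightarrow> real \<Rightarrow> real \<Rightarrow> real \<Rightarrow> real \<Rightarrow> real" where
  "added_mass_speed ap am rp rm cp cm \<kappa> = sqrt (added_mass_speed_sq ap am rp rm cp cm \<kappa>)"

definition wood_speed ::
    "real \<Rightarrow> real \<Rightarrow> real \<Rightarrow> real \<Rightarrow> real \<Rightarrow> real \<Rightarrow> real" where
  "wood_speed ap am rp rm cp cm = sqrt (wood_speed_sq ap am rp rm cp cm)"

text \<open>
  Under the standing assumptions the two radicands are positive, so each speed is the unique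
  positive real with the prescribed square.
\<close>

lemma convex_comb_pos:
  fixes a b x y :: real
  assumes "a \<ge> 0" "b \<ge> 0" "a + b = 1" "x > 0" "y > 0"
  shows "a * x + b * y > 0"
proof (cases "a = 0")
  case True
  then show ?thesis using assms by simp
next
  case False
  then have "a * x > 0" using assms by simp
  moreover have "b * y \<ge> 0" using assms by simp
  ultimately show ?thesis by linarith
qed

lemma
  assumes "ap \<ge> 0" "am \<ge> 0" "ap + am = 1" "rp > 0" "rm > 0" "cp > 0" "cm > 0"
  shows wood_speed_pos: "wood_speed ap am rp rm cp cm > 0"
    and wood_speed_square: "(wood_speed ap am rp rm cp cm)\<^sup>2 = wood_speed_sq ap am rp rm cp cm"
proof -
  have "mixture_density ap am rp rm > 0"
    using assms by (simp add: mixture_density_def convex_comb_pos)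
  moreover have "ap * rm * cm\<^sup>2 + am * rp * cp\<^sup>2 > 0"
    using convex_comb_pos[of ap am "rm * cm\<^sup>2" "rp * cp\<^sup>2"] assms by (simp add: mult.assoc)
  ultimately have "wood_speed_sq ap am rp rm cp cm > 0"
    using assms by (simp add: wood_speed_sq_def Let_def)
  then show "wood_speed ap am rp rm cp cm > 0"
    and "(wood_speed ap am rp rm cp cm)\<^sup>2 = wood_speed_sq ap am rp rm cp cm"
    by (simp_all add: wood_speed_def)
qed

lemma
  assumes "ap \<ge> 0" "am \<ge> 0" "ap + am = 1" "rp > 0" "rm > 0" "cp > 0" "cm > 0" "\<kappa> \<ge> 0"
  shows added_mass_speed_pos: "added_mass_speed ap am rp rm cp cm \<kappa> > 0"
    and added_mass_speed_square:
      "(added_mass_speed ap am rp rm cp cm \<kappa>)\<^sup>2 = added_mass_speed_sq ap am rp rm cp cm \<kappa>"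
proof -
  have r: "mixture_density ap am rp rm > 0"
    using assms by (simp add: mixture_density_def convex_comb_pos)
  have d: "ap * rm * cm\<^sup>2 + am * rp * cp\<^sup>2 > 0"
    using convex_comb_pos[of ap am "rm * cm\<^sup>2" "rp * cp\<^sup>2"] assms by (simp add: mult.assoc)
  define q where "q x = (mixture_density ap am rp rm + \<kappa> * x) /
    (mixture_density ap am rp rm * (1 + \<kappa>) * x)" for x
  have "q x > 0" if "x > 0" for x
    using r assms(8) that unfolding q_def
    by (intro divide_pos_pos mult_pos_pos add_pos_nonneg mult_nonneg_nonneg) auto
  then have "ap * q rp + am * q rm > 0"
    using assms by (intro convex_comb_pos) auto
  moreover have "(rp * rm * cp\<^sup>2 * cm\<^sup>2) / (ap * rm * cm\<^sup>2 + am * rp * cp\<^sup>2) > 0"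
    using d assms by simp
  ultimately have "added_mass_speed_sq ap am rp rm cp cm \<kappa> > 0"
    unfolding added_mass_speed_sq_def Let_def q_def by (rule mult_pos_pos)
  then show "added_mass_speed ap am rp rm cp cm \<kappa> > 0"
    and "(added_mass_speed ap am rp rm cp cm \<kappa>)\<^sup>2 = added_mass_speed_sq ap am rp rm cp cm \<kappa>"
    by (simp_all add: added_mass_speed_def)
qed

end

(* Splitting (rho + kappa r) / (rho (1 + kappa) r) = (1/r + kappa/rho) / (1 + kappa) in both phases and
   using alpha+ + alpha- = 1 exhibits c_kappa^2 as the mean of c_0^2 and c_w^2 with weights 1 and
   kappa, so c_kappa^2 tends to c_w^2.  For the comparison,
   (alpha- rho+ + alpha+ rho-) rho - rho+ rho- = alpha+ alpha- (rho+ - rho-)^2. *)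
theory Submission
  imports Defs
begin

text \<open>At \<open>\<kappa> = 0\<close> the mixture density cancels in each phase, leaving
  \<open>ap / rp + am / rm\<close>; the factor \<open>rp * rm\<close> of the common quotient then
  clears both denominators.\<close>

lemma added_mass_speed_sq_0:
  assumes "rp > 0" "rm > 0" "mixture_density ap am rp rm > 0"
  shows "added_mass_speed_sq ap am rp rm cp cm 0 =
    ((am * rp + ap * rm) * cp\<^sup>2 * cm\<^sup>2) / (ap * rm * cm\<^sup>2 + am * rp * cp\<^sup>2)"
proof -
  have "(ap / rp + am / rm) * (rp * rm * cp\<^sup>2 * cm\<^sup>2) = (am * rp + ap * rm) * cp\<^sup>2 * cm\<^sup>2"
    using assms(1,2) by (simp add: field_simps)
  then show ?thesis
    using assms(3) by (simp add: added_mass_speed_sq_def Let_def)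
qed

lemma added_mass_speed_sq_weighted_mean:
  assumes "ap + am = 1" "rp > 0" "rm > 0" "mixture_density ap am rp rm > 0"
  shows "added_mass_speed_sq ap am rp rm cp cm \<kappa> =
    (\<kappa> * wood_speed_sq ap am rp rm cp cm + added_mass_speed_sq ap am rp rm cp cm 0) / (\<kappa> + 1)"
proof -
  define R where "R = mixture_density ap am rp rm"
  define Q where "Q = rp * rm * cp\<^sup>2 * cm\<^sup>2 / (ap * rm * cm\<^sup>2 + am * rp * cp\<^sup>2)"
  \<comment> \<open>This also covers \<open>\<kappa> = -1\<close>: both sides are then 0, because
    division by 0 yields 0.\<close>
  have split: "(R + \<kappa> * r) / (R * (1 + \<kappa>) * r) = (1 / r + \<kappa> / R) / (\<kappa> + 1)" if "r > 0" for r
  proof -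
    have "1 / r + \<kappa> / R = (R + \<kappa> * r) / (R * r)"
      using that assms(4) by (simp add: R_def add_frac_eq mult.commute)
    then show ?thesis
      by (simp add: ac_simps)
  qed
  have w: "wood_speed_sq ap am rp rm cp cm = Q / R"
    by (simp add: wood_speed_sq_def Let_def Q_def R_def mult.commute)
  have z: "added_mass_speed_sq ap am rp rm cp cm 0 = (ap / rp + am / rm) * Q"
    using assms(4) by (simp add: added_mass_speed_sq_def Let_def Q_def)
  \<comment> \<open>Regrouping collects the coefficient \<open>ap + am\<close> of
    \<open>\<kappa> / R\<close>; it equals 1, so the \<open>\<kappa>\<close>-term times
    \<open>Q\<close> becomes \<open>\<kappa>\<close> times Wood's \<open>Q / R\<close>.\<close>
  have "ap * ((1 / rp + \<kappa> / R) / (\<kappa> + 1)) + am * ((1 / rm + \<kappa> / R) / (\<kappa> + 1))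
      = (ap / rp + am / rm + (ap + am) * (\<kappa> / R)) / (\<kappa> + 1)"
    by (simp add: add_divide_distrib distrib_left distrib_right)
  then have "added_mass_speed_sq ap am rp rm cp cm \<kappa>
      = (ap / rp + am / rm + \<kappa> / R) / (\<kappa> + 1) * Q"
    unfolding added_mass_speed_sq_def Let_def R_def[symmetric] Q_def[symmetric]
      split[OF assms(2)] split[OF assms(3)]
    using assms(1) by simp
  then show ?thesis
    unfolding w z by (simp add: algebra_simps)
qed

text \<open>The gap is kept as a product: once the last factor is known to be positive, both its
  sign and its vanishing are those of \<open>ap * am * (rp - rm)\<^sup>2\<close>.\<close>

lemma added_mass_speed_sq_0_minus_wood_speed_sq:
  assumes "ap + am = 1" "rp > 0" "rm > 0" "mixture_density ap am rp rm > 0"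
  shows "added_mass_speed_sq ap am rp rm cp cm 0 - wood_speed_sq ap am rp rm cp cm =
    ap * am * (rp - rm)\<^sup>2 *
      (cp\<^sup>2 * cm\<^sup>2 / (mixture_density ap am rp rm * (ap * rm * cm\<^sup>2 + am * rp * cp\<^sup>2)))"
proof -
  define R where "R = mixture_density ap am rp rm"
  define D where "D = ap * rm * cm\<^sup>2 + am * rp * cp\<^sup>2"
  have am: "am = 1 - ap"
    using assms(1) by simp
  have key: "(am * rp + ap * rm) * R - rp * rm = ap * am * (rp - rm)\<^sup>2"
    unfolding R_def mixture_density_def am by (simp add: power2_eq_square algebra_simps)
  \<comment> \<open>Expanding the first quotient by \<open>R\<close> puts both squared speeds over
    \<open>R * D\<close>, so that \<open>key\<close> applies to the difference of
    numerators.\<close>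
  have "R \<noteq> 0"
    using assms(4) by (simp add: R_def)
  then have "(am * rp + ap * rm) * cp\<^sup>2 * cm\<^sup>2 / D
      = (am * rp + ap * rm) * R * (cp\<^sup>2 * cm\<^sup>2 / (R * D))"
    by (simp add: mult.assoc mult.left_commute[of _ R])
  then have "(am * rp + ap * rm) * cp\<^sup>2 * cm\<^sup>2 / D - rp * rm * cp\<^sup>2 * cm\<^sup>2 / (R * D)
      = ((am * rp + ap * rm) * R - rp * rm) * (cp\<^sup>2 * cm\<^sup>2 / (R * D))"
    by (simp only: left_diff_distrib diff_divide_distrib times_divide_eq_right mult.assoc)
  then show ?thesis
    unfolding key using added_mass_speed_sq_0[OF assms(2-4)]
    by (simp add: wood_speed_sq_def Let_def flip: R_def D_def)
qed

text \<open>For \<open>x > 0\<close> the quotient equals \<open>a + (b - a) / (x + 1)\<close>, whose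
  second term vanishes in the limit.\<close>

lemma weighted_mean_tendsto_at_top:
  fixes a b :: real
  shows "((\<lambda>x. (x * a + b) / (x + 1)) \<longlongrightarrow> a) at_top"
proof -
  have "((\<lambda>x::real. inverse (x + 1)) \<longlongrightarrow> 0) at_top"
    using filterlim_tendsto_add_at_top[OF tendsto_const[of 1] filterlim_ident]
    by (intro tendsto_inverse_0_at_top) (simp add: add.commute)
  then have "((\<lambda>x. a + (b - a) * inverse (x + 1)) \<longlongrightarrow> a + (b - a) * 0) at_top"
    by (intro tendsto_intros)
  moreover have "\<forall>\<^sub>F x in at_top. a + (b - a) * inverse (x + 1) = (x * a + b) / (x + 1)"
    using eventually_gt_at_top[of 0] by eventually_elim (simp add: field_simps)
  ultimately show ?thesis
    by (auto intro: Lim_transform_eventually)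
qed

theorem mainTheorem4:
  fixes ap am rp rm cp cm c0 cw :: real and c :: "real \<Rightarrow> real"
  assumes "ap \<ge> 0" and "am \<ge> 0" and "ap + am = 1"
    and "rp > 0" and "rm > 0" and "cp > 0" and "cm > 0"
  defines "c \<equiv> added_mass_speed ap am rp rm cp cm"
    and "c0 \<equiv> added_mass_speed ap am rp rm cp cm 0"
    and "cw \<equiv> wood_speed ap am rp rm cp cm"
  shows
    "(c0\<^sup>2 = ((am * rp + ap * rm) * cp\<^sup>2 * cm\<^sup>2) / (ap * rm * cm\<^sup>2 + am * rp * cp\<^sup>2)
        \<and> (c \<longlongrightarrow> cw) at_top)
     \<and> (c0 \<ge> cw \<and> (c0 = cw \<longleftrightarrow> ap * am * (rp - rm)\<^sup>2 = 0))
     \<and> (\<forall>\<kappa>\<ge>0. (c \<kappa>)\<^sup>2 = (\<kappa> * cw\<^sup>2 + c0\<^sup>2) / (\<kappa> + 1))"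
proof -
  note phys = assms(1-7)
  define D where "D = ap * rm * cm\<^sup>2 + am * rp * cp\<^sup>2"
  have R: "mixture_density ap am rp rm > 0"
    using phys by (simp add: mixture_density_def convex_comb_pos)
  \<comment> \<open>\<open>D\<close> is a convex combination of the positive numbers
    \<open>rm * cm\<^sup>2\<close> and \<open>rp * cp\<^sup>2\<close>, hence positive even if one
    phase is absent.\<close>
  have D: "D > 0"
    using convex_comb_pos[of ap am "rm * cm\<^sup>2" "rp * cp\<^sup>2"] phys by (simp add: D_def mult.assoc)
  have c_sq: "(c \<kappa>)\<^sup>2 = added_mass_speed_sq ap am rp rm cp cm \<kappa>" and c_pos: "c \<kappa> > 0"
    if "\<kappa> \<ge> 0" for \<kappa>
    using that phys by (simp_all add: c_def added_mass_speed_square added_mass_speed_pos)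
  have c0: "c0 = c 0"
    by (simp add: c0_def c_def)
  have cw_sq: "cw\<^sup>2 = wood_speed_sq ap am rp rm cp cm" and cw_pos: "cw > 0"
    using phys by (simp_all add: cw_def wood_speed_square wood_speed_pos)
  have c0_sq: "c0\<^sup>2 = added_mass_speed_sq ap am rp rm cp cm 0" and c0_pos: "c0 > 0"
    by (simp_all add: c0 c_sq c_pos)
  have mean: "(c \<kappa>)\<^sup>2 = (\<kappa> * cw\<^sup>2 + c0\<^sup>2) / (\<kappa> + 1)" if "\<kappa> \<ge> 0" for \<kappa>
    unfolding c_sq[OF that] cw_sq c0_sq
    using added_mass_speed_sq_weighted_mean phys R by blast
  have lim: "(c \<longlongrightarrow> cw) at_top"
  proof -
    have "((\<lambda>\<kappa>. sqrt ((\<kappa> * cw\<^sup>2 + c0\<^sup>2) / (\<kappa> + 1))) \<longlongrightarrow> sqrt (cw\<^sup>2)) at_top"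
      by (intro tendsto_real_sqrt weighted_mean_tendsto_at_top)
    \<comment> \<open>The square root recovers \<open>c \<kappa>\<close> from its square only where
      \<open>c \<kappa>\<close> is known to be nonnegative, here for
      \<open>\<kappa> \<ge> 0\<close>; this suffices at infinity.\<close>
    moreover have "\<forall>\<^sub>F \<kappa> in at_top. sqrt ((\<kappa> * cw\<^sup>2 + c0\<^sup>2) / (\<kappa> + 1)) = c \<kappa>"
      using eventually_ge_at_top[of 0]
    proof eventually_elim
      case (elim \<kappa>)
      then show ?case
        using mean[OF elim, symmetric] c_pos[OF elim] by simp
    qed
    ultimately show ?thesis
      using cw_pos by (auto intro: Lim_transform_eventually)
  qed
  define g where "g = cp\<^sup>2 * cm\<^sup>2 / (mixture_density ap am rp rm * D)"
  have g: "g > 0"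
    using R D phys by (simp add: g_def)
  have gap: "c0\<^sup>2 - cw\<^sup>2 = ap * am * (rp - rm)\<^sup>2 * g"
    unfolding c0_sq cw_sq g_def D_def
    using added_mass_speed_sq_0_minus_wood_speed_sq phys R by blast
  have "ap * am * (rp - rm)\<^sup>2 * g \<ge> 0"
    using g phys by simp
  then have "cw\<^sup>2 \<le> c0\<^sup>2"
    using gap by linarith
  then have le: "cw \<le> c0"
    by (rule power2_le_imp_le) (use c0_pos in linarith)
  \<comment> \<open>Both speeds are positive, so they agree exactly when their squares do;
    cancelling \<open>g > 0\<close> from the gap then gives the criterion.\<close>
  have "c0 = cw \<longleftrightarrow> c0\<^sup>2 - cw\<^sup>2 = 0"
    using power2_eq_iff_nonneg[of c0 cw] c0_pos cw_pos by linarith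
  then have eq: "c0 = cw \<longleftrightarrow> ap * am * (rp - rm)\<^sup>2 = 0"
    unfolding gap using less_imp_neq[OF g] by (metis mult_eq_0_iff)
  show ?thesis
    using c0_sq added_mass_speed_sq_0[OF \<open>rp > 0\<close> \<open>rm > 0\<close> R] lim le eq mean by (intro conjI allI impI) simp_all
qed

end
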